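(* A regular Hausdorff space $X$ has a $W_\delta$-diagonal if and only if $\mathcal{F}(X)$ has a $W_\delta$-diagonal.
   Context: $\mathcal{F}(X)$ is the set of nonempty finite subsets of $X$ with the Vietoris topology (base: $\langle U_1,\dots,U_k\rangle=\{A: A\subset\bigcup_i U_i,\ A\cap U_j\neq\emptyset\ \forall j\}$, $U_i$ open in $X$). A space $Y$ has a $W_\delta$-diagonal if there is a sequence $\{\mathcal{B}_n\}$ of bases of $Y$ such that whenever $x\in b_n\in\mathcal{B}_n$ for all $n$ and $\{b_n\}$ is decreasing, $\bigcap_n b_n=\{x\}$. *)

theory Defs
  imports "HOL-Analysis.Analysis"
begin

definition vietoris_basic :: "'a set set \<Rightarrow> 'a set set" where
  "vietoris_basic \<U> = {A. finite A \<and> A \<noteq> {} \<and> A \<subseteq> \<Union>\<U> \<and> (\<forall>U\<in>\<U>. A \<inter> U \<noteq> {})}"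

definition finite_vietoris :: "'a topology \<Rightarrow> 'a set topology" where
  "finite_vietoris X = topology_generated_by
     {vietoris_basic \<U> | \<U>. finite \<U> \<and> \<U> \<noteq> {} \<and> (\<forall>U\<in>\<U>. openin X U)}"

definition is_base :: "'b topology \<Rightarrow> 'b set set \<Rightarrow> bool" where
  "is_base Y \<B> \<longleftrightarrow> openin Y = arbitrary union_of (\<lambda>V. V \<in> \<B>)"

definition W_delta_diagonal :: "'b topology \<Rightarrow> bool" where
  "W_delta_diagonal Y \<longleftrightarrow>
     (\<exists>\<B> :: nat \<Rightarrow> 'b set set. (\<forall>n. is_base Y (\<B> n)) \<and>
        (\<forall>x b. (\<forall>n. x \<in> b n \<and> b n \<in> \<B> n) \<and> decseq b \<longrightarrow> (\<Inter>n. b n) = {x}))"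

end

theory Submission
  imports Defs
begin

text \<open>
  Having a \<open>W\<^sub>\<delta>\<close>-diagonal is equivalent to having a sieve, a tree of open sets in which every
  node is the union of its children, such that the sets along a branch have at most one common
  point. Unlike the definition through bases, this passes to preimages under continuous injections,
  in particular under \<open>x \<mapsto> {x}\<close>. Conversely, finite sets \<open>S\<close> of nodes, read as the Vietoris sets
  \<open>\<langle>G t : t \<in> S\<rangle>\<close>, form a sieve of the hyperspace. If \<open>A\<close> and \<open>B\<close> lie on a common branch of it and
  \<open>x \<in> A\<close>, then Koenig's lemma gives a branch through the finite node sets all of whose sets contain
  \<open>x\<close>; the finite set \<open>B\<close> meets all of these decreasing sets, so some point of \<open>B\<close> is in all of them
  and equals \<open>x\<close>. Hence \<open>A \<subseteq> B\<close>, and by symmetry \<open>A = B\<close>.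
\<close>

section \<open>Sieves, branches and separation\<close>

text \<open>The node type is left free because both level-tagged open sets and finite sets of other
  nodes occur as nodes. The union condition makes \<open>G\<close> decrease along branches.\<close>

definition sieve ::
    "'b topology \<Rightarrow> 't set \<Rightarrow> 't set \<Rightarrow> ('t \<Rightarrow> 't set) \<Rightarrow> ('t \<Rightarrow> 'b set) \<Rightarrow> bool" where
  "sieve Y T N R G \<longleftrightarrow> N \<subseteq> T \<and> topspace Y = \<Union>(G ` N) \<and>
     (\<forall>t\<in>T. openin Y (G t) \<and> R t \<subseteq> T \<and> G t = \<Union>(G ` R t))"

definition branch :: "'t set \<Rightarrow> ('t \<Rightarrow> 't set) \<Rightarrow> (nat \<Rightarrow> 't) \<Rightarrow> bool" where
  "branch N R b \<longleftrightarrow> b 0 \<in> N \<and> (\<forall>n. b (Suc n) \<in> R (b n))"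

text \<open>Branches with empty intersection are tolerated; they can arise when a sieve is pulled
  back along a map.\<close>

definition separating :: "'t set \<Rightarrow> ('t \<Rightarrow> 't set) \<Rightarrow> ('t \<Rightarrow> 'b set) \<Rightarrow> bool" where
  "separating N R G \<longleftrightarrow>
     (\<forall>b x y. branch N R b \<and> (\<forall>n. x \<in> G (b n)) \<and> (\<forall>n. y \<in> G (b n)) \<longrightarrow> x = y)"

lemma sieveD:
  assumes "sieve Y T N R G" "t \<in> T"
  shows "openin Y (G t)" and "R t \<subseteq> T" and "G t = \<Union>(G ` R t)"
  using assms unfolding sieve_def by blast+

lemma separatingD:
  assumes "separating N R G" "branch N R b" "\<And>n. x \<in> G (b n)" "\<And>n. y \<in> G (b n)"
  shows "x = y"
  using assms unfolding separating_def by blast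

section \<open>From bases to a sieve\<close>

lemma is_base_iff:
  "is_base Y \<B> \<longleftrightarrow> (\<forall>V\<in>\<B>. openin Y V) \<and> (\<forall>W x. openin Y W \<and> x \<in> W \<longrightarrow> (\<exists>V\<in>\<B>. x \<in> V \<and> V \<subseteq> W))"
  (is "?L \<longleftrightarrow> ?R")
proof
  assume ?L
  then have op: "openin Y = arbitrary union_of (\<lambda>V. V \<in> \<B>)"
    by (simp add: is_base_def)
  have "openin Y V" if "V \<in> \<B>" for V
    unfolding op using that by (simp add: union_of_inc arbitrary_def)
  moreover have "\<exists>V\<in>\<B>. x \<in> V \<and> V \<subseteq> W" if "openin Y W" "x \<in> W" for W x
    using that unfolding op union_of_def arbitrary_def by blast
  ultimately show ?R by blast
next
  assume R: ?R
  have "openin Y W = (arbitrary union_of (\<lambda>V. V \<in> \<B>)) W" for W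
  proof
    assume W: "openin Y W"
    have "W = \<Union>{V \<in> \<B>. V \<subseteq> W}"
      using R W by blast
    then show "(arbitrary union_of (\<lambda>V. V \<in> \<B>)) W"
      unfolding union_of_def arbitrary_def
      by (intro exI[of _ "{V \<in> \<B>. V \<subseteq> W}"]) auto
  next
    assume "(arbitrary union_of (\<lambda>V. V \<in> \<B>)) W"
    then show "openin Y W"
      using R unfolding union_of_def arbitrary_def by blast
  qed
  then show ?L
    unfolding is_base_def by blast
qed

text \<open>Nodes carry their level, since one set may belong to several of the bases while its
  children must come from the next one. Children are subsets, so a branch is a decreasing sequence
  to which the diagonal condition applies.\<close>

lemma W_delta_diagonal_imp_sieve:
  assumes "W_delta_diagonal Y"
  obtains T :: "(nat \<times> 'b set) set" and N R and G :: "nat \<times> 'b set \<Rightarrow> 'b set"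
  where "sieve Y T N R G" "separating N R G"
proof -
  obtain \<B> where base: "\<And>n. is_base Y (\<B> n)"
    and lim: "\<And>x b. (\<forall>n. x \<in> b n \<and> b n \<in> \<B> n) \<Longrightarrow> decseq b \<Longrightarrow> (\<Inter>n. b n) = {x}"
    using assms unfolding W_delta_diagonal_def by metis
  define T where "T = {(n, V) | n V. V \<in> \<B> n}"
  define N where "N = {(0::nat, V) | V. V \<in> \<B> 0}"
  define R where "R = (\<lambda>(n, V). {(Suc n, V') | V'. V' \<in> \<B> (Suc n) \<and> V' \<subseteq> V})"
  have op: "openin Y V" if "V \<in> \<B> n" for V n
    using base[of n] that by (auto simp: is_base_iff)
  have ex: "\<exists>V\<in>\<B> n. x \<in> V \<and> V \<subseteq> W" if "openin Y W" "x \<in> W" for n W x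
    using base[of n] that by (auto simp: is_base_iff)
  have "sieve Y T N R snd"
    unfolding sieve_def
  proof (intro conjI ballI)
    show "N \<subseteq> T"
      by (auto simp: N_def T_def)
    show "topspace Y = \<Union>(snd ` N)"
    proof
      show "topspace Y \<subseteq> \<Union>(snd ` N)"
        using ex[OF openin_topspace, of _ 0] by (fastforce simp: N_def)
      show "\<Union>(snd ` N) \<subseteq> topspace Y"
        using openin_subset[OF op] by (fastforce simp: N_def)
    qed
    fix t assume "t \<in> T"
    then obtain n V where t: "t = (n, V)" "V \<in> \<B> n"
      by (auto simp: T_def)
    show "openin Y (snd t)"
      using op t by auto
    show "R t \<subseteq> T"
      by (auto simp: t R_def T_def)
    \<comment> \<open>The next base is applied inside the open set \<open>V\<close> itself.\<close>
    show "snd t = \<Union>(snd ` R t)"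
      using ex[OF op[OF t(2)], of _ "Suc n"] by (fastforce simp: R_def t(1))
  qed
  moreover have "separating N R snd"
    unfolding separating_def
  proof (intro allI impI; elim conjE)
    fix b x y
    assume b: "branch N R b" and x: "\<forall>n. x \<in> snd (b n)" and y: "\<forall>n. y \<in> snd (b n)"
    have fst: "fst (b n) = n \<and> snd (b n) \<in> \<B> n" for n
    proof (induction n)
      case 0
      then show ?case using b by (auto simp: branch_def N_def)
    next
      case (Suc n)
      moreover have "b (Suc n) \<in> R (b n)" using b by (simp add: branch_def)
      ultimately show ?case by (auto simp: R_def split: prod.splits)
    qed
    have "snd (b (Suc n)) \<subseteq> snd (b n)" for n
    proof -
      have "b (Suc n) \<in> R (b n)" using b by (simp add: branch_def)
      then show ?thesis by (auto simp: R_def split: prod.splits)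
    qed
    then have dec: "decseq (\<lambda>n. snd (b n))"
      by (rule decseq_SucI)
    have "(\<Inter>n. snd (b n)) = {x}" "(\<Inter>n. snd (b n)) = {y}"
      using lim[of _ "\<lambda>n. snd (b n)"] dec fst x y by blast+
    then show "x = y" by simp
  qed
  ultimately show thesis
    using that by blast
qed

section \<open>From a separating sieve back to bases\<close>

text \<open>Once the minimal value of the tail is attained, later values cannot go below it. The
  start \<open>M\<close> leaves room for comparisons that hold only from some index on.\<close>

lemma wf_nonincreasing_eventually_const:
  fixes u :: "nat \<Rightarrow> 't"
  assumes wf: "wf (r - Id)" and le: "\<And>n m. M \<le> n \<Longrightarrow> n \<le> m \<Longrightarrow> (u m, u n) \<in> r"
  obtains c M' where "\<And>m. M' \<le> m \<Longrightarrow> u m = c"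
proof -
  have "u M \<in> u ` {M..}" by simp
  then obtain c where c: "c \<in> u ` {M..}" "\<And>z. (z, c) \<in> r - Id \<Longrightarrow> z \<notin> u ` {M..}"
    using wfE_min[OF wf] by metis
  then obtain n where n: "M \<le> n" "u n = c" by auto
  have "u m = c" if "n \<le> m" for m
    using le[OF n(1) that] c(2)[of "u m"] n that by auto
  then show thesis by (rule that)
qed

text \<open>
  Each point picks its least branch in a well-ordering of the nodes, and the \<open>n\<close>-th base consists of
  the open sets inside the \<open>n\<close>-th node of the branch of one of their own points. For a decreasing
  sequence the chosen nodes of any fixed level are nonincreasing, hence eventually constant.
\<close>
lemma sieve_imp_W_delta_diagonal:
  fixes T :: "'t set"
  assumes S: "sieve Y T N R G" and sep: "separating N R G"
  shows "W_delta_diagonal Y"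
proof -
  obtain r :: "'t rel" where r: "well_order_on UNIV r"
    using well_order_on by blast
  then have wf: "wf (r - Id)"
    by (simp add: well_order_on_def)
  have least: "\<exists>c\<in>A. \<forall>z\<in>A. (c, z) \<in> r" if ne: "A \<noteq> {}" for A
  proof -
    obtain a where "a \<in> A" using ne by blast
    obtain c where "c \<in> A" "\<And>z. (z, c) \<in> r - Id \<Longrightarrow> z \<notin> A"
      using wfE_min[OF wf \<open>a \<in> A\<close>] by blast
    moreover have "(c, z) \<in> r \<or> (z, c) \<in> r" for z
      using r unfolding well_order_on_def linear_order_on_def partial_order_on_def preorder_on_def
      by (metis UNIV_I refl_onD total_on_def)
    ultimately show ?thesis by blast
  qed
  define mn where "mn A = (SOME c. c \<in> A \<and> (\<forall>z\<in>A. (c, z) \<in> r))" for A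
  have mn: "mn A \<in> A" "\<And>z. z \<in> A \<Longrightarrow> (mn A, z) \<in> r" if "A \<noteq> {}" for A
    using someI_ex[OF least[OF that, unfolded Bex_def]] unfolding mn_def by blast+
  \<comment> \<open>The greedy branch through \<open>x\<close>. It is meaningful only for
    \<open>x\<close> in the space, where the sets passed to \<open>mn\<close> are nonempty.\<close>
  define p where
    "p x = rec_nat (mn {t\<in>N. x \<in> G t}) (\<lambda>_ t. mn {s\<in>R t. x \<in> G s})" for x
  have p0: "p x 0 = mn {t\<in>N. x \<in> G t}" and pS: "p x (Suc n) = mn {s\<in>R (p x n). x \<in> G s}" for x n
    by (simp_all add: p_def)
  have ne0: "{t\<in>N. x \<in> G t} \<noteq> {}" if "x \<in> topspace Y" for x
    using S that by (auto simp: sieve_def)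
  have neS: "{s\<in>R t. x \<in> G s} \<noteq> {}" if "t \<in> T" "x \<in> G t" for x t
    using sieveD(3)[OF S that(1)] that(2) by blast
  have p: "p x n \<in> T \<and> x \<in> G (p x n)" if "x \<in> topspace Y" for x n
  proof (induction n)
    case 0
    show ?case using mn(1)[OF ne0[OF that]] S by (auto simp: p0 sieve_def)
  next
    case (Suc n)
    then show ?case using mn(1)[OF neS, of "p x n" x] sieveD(2)[OF S] unfolding pS by blast
  qed
  have pR: "p x (Suc n) \<in> R (p x n)" if "x \<in> topspace Y" for x n
    using mn(1)[OF neS, of "p x n" x] p[OF that] unfolding pS by blast
  have pG: "G (p x n) \<subseteq> G (p x k)" if "x \<in> topspace Y" "k \<le> n" for x k n
  proof -
    have "G (p x (Suc n)) \<subseteq> G (p x n)" for n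
      using sieveD(3)[OF S, of "p x n"] p[OF that(1)] pR[OF that(1)] by blast
    then show ?thesis
      using that(2) by (rule lift_Suc_antimono_le)
  qed
  define \<B> where "\<B> n = {V. openin Y V \<and> (\<exists>z\<in>V. V \<subseteq> G (p z n))}" for n
  have "is_base Y (\<B> n)" for n
    unfolding is_base_iff
  proof (intro conjI allI impI ballI; (elim conjE)?)
    show "openin Y V" if "V \<in> \<B> n" for V
      using that by (simp add: \<B>_def)
    fix W x assume W: "openin Y W" "x \<in> W"
    then have x: "x \<in> topspace Y" using openin_subset by blast
    have "openin Y (G (p x n))"
      using p[OF x, of n] sieveD(1)[OF S] by blast
    \<comment> \<open>The point \<open>x\<close> is its own witness \<open>z\<close>.\<close>
    then have "W \<inter> G (p x n) \<in> \<B> n"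
      using W p[OF x, of n] by (auto simp: \<B>_def)
    then show "\<exists>V\<in>\<B> n. x \<in> V \<and> V \<subseteq> W"
      using W p[OF x, of n] by blast
  qed
  moreover have "(\<Inter>n. b n) = {x}"
    if b: "\<forall>n. x \<in> b n \<and> b n \<in> \<B> n" and dec: "decseq b" for x b
  proof -
    have "\<exists>z. z \<in> b n \<and> b n \<subseteq> G (p z n)" for n
      using b by (auto simp: \<B>_def)
    then obtain z where z: "\<And>n. z n \<in> b n" "\<And>n. b n \<subseteq> G (p (z n) n)"
      by metis
    have zY: "z n \<in> topspace Y" for n
      using b z(1)[of n] openin_subset by (fastforce simp: \<B>_def)
    have sub: "b m \<subseteq> G (p (z n) k)" if "k \<le> n" "n \<le> m" for k n m
      using decseqD[OF dec that(2)] z(2)[of n] pG[OF zY that(1)] by blast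
    have zG: "z m \<in> G (p (z n) k)" if "k \<le> n" "n \<le> m" for k n m
      using sub[OF that] z(1) by blast
    have "\<exists>c M. \<forall>m\<ge>M. p (z m) k = c" for k
    proof (induction k)
      case 0
      have "(p (z m) 0, p (z n) 0) \<in> r" if "0 \<le> n" "n \<le> m" for n m
      proof -
        have "p (z n) 0 \<in> {t\<in>N. z m \<in> G t}"
          using zG[of 0 n m] that mn(1)[OF ne0[OF zY]] by (auto simp: p0)
        then show ?thesis unfolding p0[of "z m"]
          by (intro mn(2)) auto
      qed
      then show ?case
        using wf_nonincreasing_eventually_const[OF wf, of 0 "\<lambda>n. p (z n) 0"] by metis
    next
      case (Suc k)
      then obtain c M where M: "\<And>m. M \<le> m \<Longrightarrow> p (z m) k = c" by blast
      \<comment> \<open>Beyond \<open>M\<close> both greedy branches pass through the same node at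
        level \<open>k\<close>, so the choice made for \<open>z n\<close> also competes in the
        minimum for \<open>z m\<close>. The bound \<open>Suc k\<close> ensures that
        \<open>z m\<close> lies in that choice.\<close>
      have "(p (z m) (Suc k), p (z n) (Suc k)) \<in> r" if "max M (Suc k) \<le> n" "n \<le> m" for n m
      proof -
        have "p (z n) (Suc k) \<in> {s\<in>R (p (z m) k). z m \<in> G s}"
          using zG[of "Suc k" n m] that pR[OF zY, of n k] M[of n] M[of m] by simp
        then show ?thesis unfolding pS[of "z m"]
          by (intro mn(2)) auto
      qed
      then show ?case
        using wf_nonincreasing_eventually_const[OF wf, of "max M (Suc k)" "\<lambda>n. p (z n) (Suc k)"]
        by metis
    qed
    then obtain c M where cM: "\<And>k m. M k \<le> m \<Longrightarrow> p (z m) k = c k"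
      by metis
    \<comment> \<open>Two adjacent levels have both settled at a late enough index, so the limit
      nodes inherit the child relation.\<close>
    have "branch N R c"
      unfolding branch_def
    proof (intro conjI allI)
      show "c 0 \<in> N"
        using mn(1)[OF ne0[OF zY], of "M 0"] cM[of 0 "M 0"] by (simp add: p0)
      show "c (Suc k) \<in> R (c k)" for k
        using pR[OF zY, of "max (M k) (M (Suc k))" k] cM[of k "max (M k) (M (Suc k))"]
          cM[of "Suc k" "max (M k) (M (Suc k))"] by simp
    qed
    moreover have "(\<Inter>n. b n) \<subseteq> G (c k)" for k
      using sub[of k "max k (M k)" "max k (M k)"] cM[of k "max k (M k)"] by auto
    ultimately have "y = x" if "y \<in> (\<Inter>n. b n)" for y
      using separatingD[OF sep, of c y x] that b by blast
    then show ?thesis using b by blast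
  qed
  ultimately show ?thesis
    unfolding W_delta_diagonal_def by blast
qed

section \<open>Pulling back along continuous injections\<close>

text \<open>Preimages of a base need not form a base, but preimages of a sieve form a sieve on the
  same tree, and injectivity preserves separation.\<close>

lemma W_delta_diagonal_continuous_injection:
  assumes f: "continuous_map X Y f" and inj: "inj_on f (topspace X)" and Y: "W_delta_diagonal Y"
  shows "W_delta_diagonal X"
proof -
  obtain T :: "(nat \<times> 'b set) set" and N R G where S: "sieve Y T N R G" and sep: "separating N R G"
    using W_delta_diagonal_imp_sieve[OF Y] by blast
  define H where "H t = {x \<in> topspace X. f x \<in> G t}" for t
  have "sieve X T N R H"
    unfolding sieve_def
  proof (intro conjI ballI)
    show "N \<subseteq> T" using S by (simp add: sieve_def)
    have "f x \<in> \<Union>(G ` N)" if "x \<in> topspace X" for x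
      using S continuous_map_funspace[OF f] that by (auto simp: sieve_def)
    then show "topspace X = \<Union>(H ` N)"
      by (auto simp: H_def)
    fix t assume t: "t \<in> T"
    show "openin X (H t)"
      unfolding H_def by (intro openin_continuous_map_preimage[OF f] sieveD(1)[OF S t])
    show "R t \<subseteq> T" using S t by (rule sieveD)
    show "H t = \<Union>(H ` R t)"
      unfolding H_def using sieveD(3)[OF S t] by blast
  qed
  moreover have "separating N R H"
    unfolding separating_def
  proof (intro allI impI; elim conjE)
    fix b x y
    assume "branch N R b" and x: "\<forall>n. x \<in> H (b n)" and y: "\<forall>n. y \<in> H (b n)"
    then have "f x = f y"
      by (intro separatingD[OF sep]) (auto simp: H_def)
    then show "x = y"
      using x y inj by (auto simp: H_def inj_on_def)
  qed
  ultimately show ?thesis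
    by (rule sieve_imp_W_delta_diagonal)
qed

section \<open>The Vietoris topology on finite sets\<close>

lemma topspace_finite_vietoris:
  "topspace (finite_vietoris X) = {A. finite A \<and> A \<noteq> {} \<and> A \<subseteq> topspace X}" (is "_ = ?F")
proof
  show "topspace (finite_vietoris X) \<subseteq> ?F"
  proof
    fix A assume "A \<in> topspace (finite_vietoris X)"
    then obtain \<U> where "A \<in> vietoris_basic \<U>" "\<forall>U\<in>\<U>. openin X U"
      unfolding finite_vietoris_def topology_generated_by_topspace by blast
    moreover from this have "\<Union>\<U> \<subseteq> topspace X"
      using openin_subset by blast
    ultimately show "A \<in> ?F"
      unfolding vietoris_basic_def by blast
  qed
  have "A \<in> vietoris_basic {topspace X}" if "A \<in> ?F" for A
    using that by (auto simp: vietoris_basic_def)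
  moreover have "vietoris_basic {topspace X} \<subseteq> topspace (finite_vietoris X)"
    unfolding finite_vietoris_def topology_generated_by_topspace
    by (intro Union_upper CollectI exI[of _ "{topspace X}"]) auto
  ultimately show "?F \<subseteq> topspace (finite_vietoris X)"
    by blast
qed

lemma openin_vietoris_basic:
  assumes "finite \<U>" "\<And>U. U \<in> \<U> \<Longrightarrow> openin X U"
  shows "openin (finite_vietoris X) (vietoris_basic \<U>)"
proof (cases "\<U> = {}")
  case True
  then have "vietoris_basic \<U> = {}" by (auto simp: vietoris_basic_def)
  then show ?thesis by simp
next
  case False
  then show ?thesis
    unfolding finite_vietoris_def using assms by (intro topology_generated_by_Basis) blast
qed

lemma continuous_map_singleton: "continuous_map X (finite_vietoris X) (\<lambda>x. {x})"
  unfolding finite_vietoris_def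
proof (rule continuous_on_generated_topo)
  fix W assume "W \<in> {vietoris_basic \<U> | \<U>. finite \<U> \<and> \<U> \<noteq> {} \<and> (\<forall>U\<in>\<U>. openin X U)}"
  then obtain \<U> where \<U>: "W = vietoris_basic \<U>" "finite \<U>" "\<U> \<noteq> {}" "\<forall>U\<in>\<U>. openin X U"
    by blast
  \<comment> \<open>A singleton meets every member of \<open>\<U>\<close> iff its point lies in all
    of them; as \<open>\<U>\<close> is nonempty, it is then covered as well.\<close>
  have "(\<lambda>x. {x}) -` W \<inter> topspace X = \<Inter>\<U>"
    using \<U> openin_subset by (fastforce simp: vietoris_basic_def)
  then show "openin X ((\<lambda>x. {x}) -` W \<inter> topspace X)"
    using \<U> by (simp add: openin_Inter)
next
  have "(\<lambda>x. {x}) ` topspace X \<subseteq> topspace (finite_vietoris X)"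
    by (auto simp: topspace_finite_vietoris)
  then show "(\<lambda>x. {x}) ` topspace X
      \<subseteq> \<Union>{vietoris_basic \<U> | \<U>. finite \<U> \<and> \<U> \<noteq> {} \<and> (\<forall>U\<in>\<U>. openin X U)}"
    unfolding finite_vietoris_def topology_generated_by_topspace .
qed

section \<open>Koenig's lemma for finite levels\<close>

text \<open>A node may have several parents and recur on several levels, so paths are tracked by
  relations between levels. The branch is built from nodes with descendants at every depth.\<close>

lemma koenig_levels:
  fixes L :: "nat \<Rightarrow> 't set"
  assumes fin: "\<And>n. finite (L n)" and ne: "\<And>n. L n \<noteq> {}"
    and pred: "\<And>n t. t \<in> L (Suc n) \<Longrightarrow> \<exists>s\<in>L n. t \<in> R s"
  obtains b where "\<And>n. b n \<in> L n" "\<And>n. b (Suc n) \<in> R (b n)"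
proof -
  define D where "D n = {(s, t). s \<in> L n \<and> t \<in> L (Suc n) \<and> t \<in> R s}" for n
  define reach where "reach n k = rec_nat Id (\<lambda>i Q. Q O D (n + i)) k" for n k
  have r0: "reach n 0 = Id" and rS: "reach n (Suc k) = reach n k O D (n + k)" for n k
    by (simp_all add: reach_def)
  \<comment> \<open>\<open>reach\<close> grows at its far end; peeling off the first edge instead is
    what lets survival pass from a node to a child.\<close>
  have rS': "reach n (Suc k) = D n O reach (Suc n) k" for n k
    by (induction k) (auto simp: r0 rS)
  have anc: "\<exists>s\<in>L n. (s, t) \<in> reach n k" if "t \<in> L (n + k)" for n k t
    using that
  proof (induction k arbitrary: t)
    case 0
    then show ?case by (auto simp: r0)
  next
    case (Suc k)
    then obtain s where "s \<in> L (n + k)" "t \<in> R s" using pred[of t "n + k"] by auto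
    then show ?case using Suc by (fastforce simp: rS D_def)
  qed
  define good where "good n s \<longleftrightarrow> s \<in> L n \<and> (\<forall>k. \<exists>t. t \<in> L (n + k) \<and> (s, t) \<in> reach n k)" for n s
  \<comment> \<open>Truncating a path shows that a node without descendants at one depth has none at
    any greater depth.\<close>
  have down: "\<exists>t\<in>L (n + k). (s, t) \<in> reach n k"
    if "t' \<in> L (n + k')" "(s, t') \<in> reach n k'" "k \<le> k'" for n k k' s t'
    using that
  proof (induction k' arbitrary: t')
    case 0
    then show ?case by auto
  next
    case (Suc k')
    show ?case
    proof (cases "k = Suc k'")
      case True
      then show ?thesis using Suc.prems by blast
    next
      case False
      from Suc.prems(2) obtain u where "(s, u) \<in> reach n k'" "u \<in> L (n + k')"
        by (auto simp: rS D_def)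
      then show ?thesis using Suc False by auto
    qed
  qed
  \<comment> \<open>Otherwise each node of a finite candidate set dies out, and so does the whole set.\<close>
  have survive: "\<exists>s\<in>C. good n s"
    if C: "C \<subseteq> L n" and all: "\<And>k. \<exists>s\<in>C. \<exists>t\<in>L (n + k). (s, t) \<in> reach n k" for C n
  proof (rule ccontr)
    assume "\<not> ?thesis"
    then have "\<forall>s\<in>C. \<exists>k. \<forall>t. t \<in> L (n + k) \<longrightarrow> (s, t) \<notin> reach n k"
      using C unfolding good_def by blast
    then obtain k where k: "\<And>s t. s \<in> C \<Longrightarrow> t \<in> L (n + k s) \<Longrightarrow> (s, t) \<notin> reach n (k s)"
      by metis
    have finC: "finite C" using C fin finite_subset by blast
    obtain s t where s: "s \<in> C" "t \<in> L (n + Max (k ` C))" "(s, t) \<in> reach n (Max (k ` C))"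
      using all[of "Max (k ` C)"] by blast
    have "k s \<le> Max (k ` C)" using finC s by simp
    then show False using down[OF s(2,3)] k[OF s(1)] by blast
  qed
  have start: "\<exists>s. good 0 s"
    using survive[of "L 0" 0] anc[of _ 0] ne by (metis ex_in_conv subset_refl)
  have step: "\<exists>t. good (Suc n) t \<and> t \<in> R s" if "good n s" for n s
  proof -
    \<comment> \<open>The child may depend on \<open>k\<close> here; \<open>survive\<close> then
      finds one child that works for all depths.\<close>
    have "\<exists>t\<in>L (Suc n) \<inter> R s. \<exists>u\<in>L (Suc n + k). (t, u) \<in> reach (Suc n) k" for k
    proof -
      obtain u where "u \<in> L (n + Suc k)" "(s, u) \<in> reach n (Suc k)"
        using \<open>good n s\<close> unfolding good_def by blast
      then show ?thesis by (auto simp: rS' D_def)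
    qed
    then show ?thesis using survive[of "L (Suc n) \<inter> R s" "Suc n"] by blast
  qed
  obtain b where "\<And>n. good n (b n)" "\<And>n. b (Suc n) \<in> R (b n)"
    using dependent_nat_choice[of good "\<lambda>n s t. t \<in> R s"] start step by metis
  then show thesis using that unfolding good_def by blast
qed

section \<open>The sieve of finite node sets on the hyperspace\<close>

lemma sieve_imp_W_delta_diagonal_finite_vietoris:
  assumes S: "sieve X T N R G" and sep: "separating N R G"
  shows "W_delta_diagonal (finite_vietoris X)"
proof -
  define T' where "T' = {P. finite P \<and> P \<subseteq> T}"
  define N' where "N' = {P. finite P \<and> P \<subseteq> N}"
  \<comment> \<open>Both conditions serve \<open>G' Q \<subseteq> G' P\<close>: the first keeps a
    member of \<open>G' Q\<close> covered by the sets of \<open>P\<close>, the second makes it meet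
    each of them.\<close>
  define R' where "R' P = {Q. finite Q \<and> Q \<subseteq> \<Union>(R ` P) \<and> (\<forall>t\<in>P. R t \<inter> Q \<noteq> {})}" for P
  define G' where "G' P = vietoris_basic (G ` P)" for P
  have NT: "N \<subseteq> T" and cover: "topspace X = \<Union>(G ` N)"
    using S by (simp_all add: sieve_def)
  have op: "openin X (G t)" and RT: "R t \<subseteq> T" and split: "G t = \<Union>(G ` R t)" if "t \<in> T" for t
    using sieveD[OF S that] .
  have "sieve (finite_vietoris X) T' N' R' G'"
    unfolding sieve_def
  proof (intro conjI ballI)
    show "N' \<subseteq> T'" using NT by (auto simp: N'_def T'_def)
    have opG': "openin (finite_vietoris X) (G' P)" if "P \<in> T'" for P
      unfolding G'_def using that op by (intro openin_vietoris_basic) (auto simp: T'_def)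
    show "topspace (finite_vietoris X) = \<Union>(G' ` N')"
    proof
      show "\<Union>(G' ` N') \<subseteq> topspace (finite_vietoris X)"
        using opG' \<open>N' \<subseteq> T'\<close> openin_subset by blast
      show "topspace (finite_vietoris X) \<subseteq> \<Union>(G' ` N')"
      proof
        fix A assume "A \<in> topspace (finite_vietoris X)"
        then have A: "finite A" "A \<noteq> {}" "A \<subseteq> topspace X"
          by (auto simp: topspace_finite_vietoris)
        then have "\<forall>x\<in>A. \<exists>t\<in>N. x \<in> G t" using cover by blast
        then obtain h where h: "\<And>x. x \<in> A \<Longrightarrow> h x \<in> N \<and> x \<in> G (h x)" by metis
        then have "h ` A \<in> N'" "A \<in> G' (h ` A)"
          using A by (auto simp: N'_def G'_def vietoris_basic_def)
        then show "A \<in> \<Union>(G' ` N')" by blast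
      qed
    qed
    fix P assume P: "P \<in> T'"
    then show "openin (finite_vietoris X) (G' P)" by (rule opG')
    show "R' P \<subseteq> T'"
      using P RT unfolding R'_def T'_def by blast
    have PT: "t \<in> T" if "t \<in> P" for t using P that by (auto simp: T'_def)
    show "G' P = \<Union>(G' ` R' P)"
    proof
      show "G' P \<subseteq> \<Union>(G' ` R' P)"
      proof
        fix A assume "A \<in> G' P"
        then have A: "finite A" "A \<noteq> {}" "A \<subseteq> \<Union>(G ` P)" "\<And>t. t \<in> P \<Longrightarrow> A \<inter> G t \<noteq> {}"
          by (auto simp: G'_def vietoris_basic_def)
        have "\<forall>t\<in>P. \<forall>x\<in>A \<inter> G t. \<exists>s\<in>R t. x \<in> G s"
          using split PT by blast
        then obtain h where h: "\<And>t x. t \<in> P \<Longrightarrow> x \<in> A \<Longrightarrow> x \<in> G t \<Longrightarrow> h t x \<in> R t \<and> x \<in> G (h t x)"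
          by (metis IntI)
        \<comment> \<open>A child is chosen for every incident pair of a node and a point, so every
          point of \<open>A\<close> is covered and every node of \<open>P\<close> has a child in
          \<open>Q\<close>.\<close>
        define Q where "Q = (\<Union>t\<in>P. h t ` (A \<inter> G t))"
        have "Q \<in> R' P"
          unfolding R'_def
        proof (intro CollectI conjI ballI)
          show "finite Q" using P A by (auto simp: Q_def T'_def)
          show "Q \<subseteq> \<Union>(R ` P)" using h by (auto simp: Q_def)
          fix t assume t: "t \<in> P"
          then obtain x where "x \<in> A" "x \<in> G t" using A(4) by blast
          then have "h t x \<in> R t" "h t x \<in> Q" using h t by (auto simp: Q_def)
          then show "R t \<inter> Q \<noteq> {}" by blast
        qed
        moreover have "A \<in> G' Q"
          unfolding G'_def vietoris_basic_def
        proof (intro CollectI conjI ballI)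
          show "A \<subseteq> \<Union>(G ` Q)"
          proof
            fix x assume "x \<in> A"
            then obtain t where "t \<in> P" "x \<in> G t" using A(3) by blast
            then show "x \<in> \<Union>(G ` Q)" using h \<open>x \<in> A\<close> by (auto simp: Q_def)
          qed
          show "A \<inter> U \<noteq> {}" if "U \<in> G ` Q" for U
            using that h by (fastforce simp: Q_def)
        qed (use A in auto)
        ultimately show "A \<in> \<Union>(G' ` R' P)" by blast
      qed
      show "\<Union>(G' ` R' P) \<subseteq> G' P"
      proof
        fix A assume "A \<in> \<Union>(G' ` R' P)"
        then obtain Q where Q: "Q \<in> R' P" "A \<in> G' Q" by blast
        have sub: "G s \<subseteq> G t" if "t \<in> P" "s \<in> R t" for s t
          using split PT that by blast
        have "A \<subseteq> \<Union>(G ` P)"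
        proof
          fix x assume "x \<in> A"
          then obtain s where s: "s \<in> Q" "x \<in> G s"
            using Q(2) by (auto simp: G'_def vietoris_basic_def)
          then obtain t where "t \<in> P" "s \<in> R t"
            using Q(1) by (auto simp: R'_def)
          then show "x \<in> \<Union>(G ` P)" using sub s by blast
        qed
        moreover have "A \<inter> G t \<noteq> {}" if t: "t \<in> P" for t
        proof -
          obtain s where "s \<in> R t" "s \<in> Q" using Q(1) t by (auto simp: R'_def)
          then show ?thesis
            using Q(2) sub[OF t] unfolding G'_def vietoris_basic_def by blast
        qed
        ultimately show "A \<in> G' P"
          using Q(2) by (auto simp: G'_def vietoris_basic_def)
      qed
    qed
  qed
  moreover have "separating N' R' G'"
    unfolding separating_def
  proof (intro allI impI; elim conjE)
    fix P A B
    assume P: "branch N' R' P" and A: "\<forall>n. A \<in> G' (P n)" and B: "\<forall>n. B \<in> G' (P n)"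
    have PS: "P (Suc n) \<in> R' (P n)" for n using P by (simp add: branch_def)
    have PT: "finite (P n) \<and> P n \<subseteq> T" for n
    proof (induction n)
      case 0
      then show ?case using P NT by (auto simp: branch_def N'_def)
    next
      case (Suc n)
      then show ?case using PS[of n] RT unfolding R'_def by blast
    qed
    have sub: "A \<subseteq> B" if A: "\<And>n. A \<in> G' (P n)" and B: "\<And>n. B \<in> G' (P n)" for A B
    proof
      fix x assume x: "x \<in> A"
      \<comment> \<open>Parents of such nodes again contain \<open>x\<close>, because
        \<open>G\<close> grows towards the root.\<close>
      define L where "L n = {t \<in> P n. x \<in> G t}" for n
      obtain b where b: "\<And>n. b n \<in> L n" "\<And>n. b (Suc n) \<in> R (b n)"
      proof (rule koenig_levels[of L R])
        show "finite (L n)" for n using PT by (simp add: L_def)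
        show "L n \<noteq> {}" for n using A[of n] x by (auto simp: L_def G'_def vietoris_basic_def)
        show "\<exists>s\<in>L n. t \<in> R s" if t: "t \<in> L (Suc n)" for n t
        proof -
          obtain s where s: "s \<in> P n" "t \<in> R s"
            using PS[of n] t unfolding R'_def L_def by blast
          then have "x \<in> G s" using split[of s] PT t unfolding L_def by blast
          then show ?thesis using s by (auto simp: L_def)
        qed
      qed blast
      have bP: "b n \<in> P n" and bx: "x \<in> G (b n)" for n
        using b(1)[of n] by (auto simp: L_def)
      have "branch N R b"
        using b(2) bP[of 0] P by (auto simp: branch_def N'_def)
      have "G (b (Suc n)) \<subseteq> G (b n)" for n
        using split[of "b n"] b(2)[of n] bP[of n] PT[of n] by blast
      then have dec: "G (b n) \<subseteq> G (b m)" if "m \<le> n" for m n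
        using that by (rule lift_Suc_antimono_le)
      have "\<exists>y\<in>B. \<forall>n. y \<in> G (b n)"
      proof (rule ccontr)
        assume "\<not> ?thesis"
        \<comment> \<open>\<open>k y\<close> is a level whose set misses \<open>y\<close>; at the
          maximum of these levels the set would miss all of \<open>B\<close>, although
          \<open>B\<close> meets every set \<open>G (b n)\<close>.\<close>
        then obtain k where k: "\<And>y. y \<in> B \<Longrightarrow> y \<notin> G (b (k y))" by metis
        have "finite B" using B[of 0] by (simp add: G'_def vietoris_basic_def)
        obtain y where y: "y \<in> B" "y \<in> G (b (Max (k ` B)))"
          using B[of "Max (k ` B)"] bP unfolding G'_def vietoris_basic_def by blast
        have "k y \<le> Max (k ` B)" using \<open>finite B\<close> y by simp
        then show False using dec k y by blast
      qed
      then show "x \<in> B"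
        using separatingD[OF sep \<open>branch N R b\<close>] bx by metis
    qed
    show "A = B"
      using sub A B by blast
  qed
  ultimately show ?thesis
    by (rule sieve_imp_W_delta_diagonal)
qed

theorem theorem4p2:
  fixes X :: "'a topology"
  assumes "regular_space X" and "Hausdorff_space X"
  shows "W_delta_diagonal X \<longleftrightarrow> W_delta_diagonal (finite_vietoris X)"
proof
  assume "W_delta_diagonal X"
  then obtain T :: "(nat \<times> 'a set) set" and N R G where "sieve X T N R G" "separating N R G"
    by (rule W_delta_diagonal_imp_sieve)
  then show "W_delta_diagonal (finite_vietoris X)"
    by (rule sieve_imp_W_delta_diagonal_finite_vietoris)
next
  show "W_delta_diagonal X" if "W_delta_diagonal (finite_vietoris X)"
    by (rule W_delta_diagonal_continuous_injection[OF continuous_map_singleton _ that]) simp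
qed

end
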